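(* The factor map $q:(Z,\zeta)\to(S^d,\varphi)$ (see context) induces an affine bijection between the $\zeta$-invariant Borel probability measures on $Z$ and the $\varphi$-invariant Borel probability measures on $S^d$.
   Context: Construction of $(Z,\zeta)$ and $q$. Let $d>1$ be an odd integer and $\varphi:S^d\to S^d$ a minimal diffeomorphism (every $\varphi$-orbit is dense). Write $B^{d-1}(r)$ for the open ball of radius $r$ centred at $0$ in $\mathbb{R}^{d-1}$ and $|\cdot|$ for the Euclidean norm. Fix $\epsilon>0$ and a continuous injection $\tau_0:[-\epsilon,1+\epsilon]\times\overline{B^{d-1}(1)}\to S^d$ such that (a) $\tau_0(s+1,x)=\varphi(\tau_0(s,x))$ for $|s|\le\epsilon$ and $x\in\overline{B^{d-1}(1)}$; (b) $\varphi^n(\tau_0([0,1)\times\{0\}))\cap\tau_0([0,1)\times\{0\})=\emptyset$ for all $n\ne0$ (such data exist). Define $\tau:\mathbb{R}\times\overline{B^{d-1}(1)}\to S^d$ by $\tau(s,x)=\varphi^{\lfloor s\rfloor}(\tau_0(s \bmod 1,x))$, where $s\bmod 1\in[0,1)$. Fix numbers $1>\rho_1>\rho_2>\cdots>0$ such that for each $n\ge1$ the restriction of $\tau$ to $[-n-2,n+2]\times\overline{B^{d-1}(2\rho_n)}$ is (defined and) injective (such numbers exist). Define $r_n:\mathbb{R}\to[0,1]$ by $r_n(s)=0$ if $|s|>n$, $r_n(s)=n-|s|$ if $n-\rho_n\le|s|\le n$, and $r_n(s)=\rho_n$ if $|s|\le n-\rho_n$. Put $L_n=\tau([-n,n]\times\{0\})$,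 $L_\infty=\tau(\mathbb{R}\times\{0\})$ and $R_n=\tau(\{(s,x)\mid -n\le s\le n,\ x\in\mathbb{R}^{d-1},\ 0<|x|\le 2r_n(s)\})$. Every point of $R_n$ is uniquely of the form $\tau(s,tx)$ with $-n\le s\le n$, $0<t\le2r_n(s)$, $x\in S^{d-2}$; define $\beta_n:S^d\setminus L_n\to S^d$ by $\beta_n(\tau(s,tx))=\tau(s,(\tfrac t2+r_n(s))x)$ on $R_n$ and $\beta_n=\mathrm{id}$ on $S^d\setminus(L_n\cup R_n)$. Fix a metric $d_0$ on $S^d$ inducing the usual topology, and define metrics $d_n(x,y)=d_0(\beta_n(x),\beta_n(y))$ on $S^d\setminus L_n$ ($n\ge1$) and $d_\infty(x,y)=\sum_{n\ge1}2^{-n}d_n(x,y)$ on $S^d\setminus L_\infty$. The space $Z$ is the completion of $S^d\setminus L_\infty$ in the metric $d_\infty$; it is compact. The set $L_\infty$ is $\varphi$-invariant, and the restriction of $\varphi$ to $S^d\setminus L_\infty$ extends to a homeomorphism $\zeta$ of $(Z,d_\infty)$. The identity map on $S^d\setminus L_\infty$ extends to a continuous surjection $q:Z\to S^d$, which satisfies $q\circ\zeta=\varphi\circ q$. The induced map on measures is push-forward along $q$. *)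

theory Defs
  imports "HOL-Probability.Probability"
begin

section \<open>Minimal diffeomorphisms of the unit sphere\<close>

text \<open>
  The sphere \<open>S^d\<close> is the unit sphere of a Euclidean space of dimension \<open>d + 1\<close>; the ball
  \<open>B^{d-1}(r)\<close> lives in a second Euclidean space, of dimension \<open>d - 1\<close>.
\<close>

abbreviation usphere :: "'a::euclidean_space set"
  where "usphere \<equiv> sphere 0 1"

text \<open>\<open>C^k\<close> on an open set: \<open>k\<close>-fold continuous differentiability through directional derivatives.\<close>

primrec Ck_on :: "nat \<Rightarrow> 'a::euclidean_space set \<Rightarrow> ('a \<Rightarrow> 'b::euclidean_space) \<Rightarrow> bool" where
  "Ck_on 0 U f \<longleftrightarrow> continuous_on U f"
| "Ck_on (Suc k) U f \<longleftrightarrow> (\<forall>x\<in>U. f differentiable (at x)) \<and>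
      (\<forall>v. Ck_on k U (\<lambda>x. frechet_derivative f (at x) v))"

text \<open>On a subset that need not be open, smoothness means having smooth local extensions.\<close>

definition smooth_on :: "'a::euclidean_space set \<Rightarrow> ('a \<Rightarrow> 'b::euclidean_space) \<Rightarrow> bool" where
  "smooth_on S f \<longleftrightarrow> (\<forall>x\<in>S. \<exists>U F. open U \<and> x \<in> U \<and> (\<forall>k. Ck_on k U F) \<and> (\<forall>y\<in>S \<inter> U. F y = f y))"

definition sphere_diffeo :: "('a::euclidean_space \<Rightarrow> 'a) \<Rightarrow> bool" where
  "sphere_diffeo \<phi> \<longleftrightarrow> bij_betw \<phi> usphere usphere \<and>
     smooth_on usphere \<phi> \<and> smooth_on usphere (inv_into usphere \<phi>)"

definition iter :: "('a::euclidean_space \<Rightarrow> 'a) \<Rightarrow> int \<Rightarrow> 'a \<Rightarrow> 'a" where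
  "iter \<phi> n = (if 0 \<le> n then \<phi> ^^ nat n else inv_into usphere \<phi> ^^ nat (- n))"

definition minimal_on_sphere :: "('a::euclidean_space \<Rightarrow> 'a) \<Rightarrow> bool" where
  "minimal_on_sphere \<phi> \<longleftrightarrow> (\<forall>x\<in>usphere. closure (range (\<lambda>n. iter \<phi> n x)) = usphere)"

section \<open>The spaces and maps of the construction\<close>

definition tau :: "('a::euclidean_space \<Rightarrow> 'a) \<Rightarrow> (real \<times> 'b::euclidean_space \<Rightarrow> 'a) \<Rightarrow> real \<times> 'b \<Rightarrow> 'a"
  where "tau \<phi> \<tau>\<^sub>0 = (\<lambda>(s, x). iter \<phi> \<lfloor>s\<rfloor> (\<tau>\<^sub>0 (frac s, x)))"

definition flow_box :: "('a::euclidean_space \<Rightarrow> 'a) \<Rightarrow> real \<Rightarrow> (real \<times> 'b::euclidean_space \<Rightarrow> 'a) \<Rightarrow> bool" where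
  "flow_box \<phi> \<epsilon> \<tau>\<^sub>0 \<longleftrightarrow>
     continuous_on ({-\<epsilon>..1 + \<epsilon>} \<times> cball 0 1) \<tau>\<^sub>0 \<and>
     inj_on \<tau>\<^sub>0 ({-\<epsilon>..1 + \<epsilon>} \<times> cball 0 1) \<and>
     \<tau>\<^sub>0 ` ({-\<epsilon>..1 + \<epsilon>} \<times> cball 0 1) \<subseteq> usphere \<and>
     (\<forall>s x. \<bar>s\<bar> \<le> \<epsilon> \<longrightarrow> x \<in> cball 0 1 \<longrightarrow> \<tau>\<^sub>0 (s + 1, x) = \<phi> (\<tau>\<^sub>0 (s, x))) \<and>
     (\<forall>n. n \<noteq> 0 \<longrightarrow> iter \<phi> n ` \<tau>\<^sub>0 ` ({0..<1} \<times> {0}) \<inter> \<tau>\<^sub>0 ` ({0..<1} \<times> {0}) = {})"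

text \<open>
  The sequences below are indexed by \<open>n \<ge> 1\<close>; values at \<open>0\<close> are irrelevant. Since \<open>tau\<close> only makes
  sense on the closed unit ball, being defined on radius \<open>2 * \<rho> n\<close> means \<open>2 * \<rho> n \<le> 1\<close>.
\<close>

definition admissible_radii ::
  "('a::euclidean_space \<Rightarrow> 'a) \<Rightarrow> (real \<times> 'b::euclidean_space \<Rightarrow> 'a) \<Rightarrow> (nat \<Rightarrow> real) \<Rightarrow> bool" where
  "admissible_radii \<phi> \<tau>\<^sub>0 \<rho> \<longleftrightarrow>
     \<rho> 1 < 1 \<and>
     (\<forall>n\<ge>1. 0 < \<rho> n \<and> \<rho> (Suc n) < \<rho> n \<and> 2 * \<rho> n \<le> 1 \<and>
        inj_on (tau \<phi> \<tau>\<^sub>0) ({- real n - 2..real n + 2} \<times> cball 0 (2 * \<rho> n)))"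

definition rr :: "(nat \<Rightarrow> real) \<Rightarrow> nat \<Rightarrow> real \<Rightarrow> real" where
  "rr \<rho> n s = (if \<bar>s\<bar> > real n then 0
               else if real n - \<rho> n \<le> \<bar>s\<bar> then real n - \<bar>s\<bar>
               else \<rho> n)"

definition LL :: "('a::euclidean_space \<Rightarrow> 'a) \<Rightarrow> (real \<times> 'b::euclidean_space \<Rightarrow> 'a) \<Rightarrow> nat \<Rightarrow> 'a set" where
  "LL \<phi> \<tau>\<^sub>0 n = tau \<phi> \<tau>\<^sub>0 ` ({- real n..real n} \<times> {0})"

definition L_inf :: "('a::euclidean_space \<Rightarrow> 'a) \<Rightarrow> (real \<times> 'b::euclidean_space \<Rightarrow> 'a) \<Rightarrow> 'a set" where
  "L_inf \<phi> \<tau>\<^sub>0 = tau \<phi> \<tau>\<^sub>0 ` (UNIV \<times> {0})"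

definition RR ::
  "('a::euclidean_space \<Rightarrow> 'a) \<Rightarrow> (real \<times> 'b::euclidean_space \<Rightarrow> 'a) \<Rightarrow> (nat \<Rightarrow> real) \<Rightarrow> nat \<Rightarrow> 'a set" where
  "RR \<phi> \<tau>\<^sub>0 \<rho> n =
     tau \<phi> \<tau>\<^sub>0 ` {(s, x). - real n \<le> s \<and> s \<le> real n \<and> 0 < norm x \<and> norm x \<le> 2 * rr \<rho> n s}"

text \<open>\<open>beta\<close> is meant on \<open>usphere - LL \<phi> \<tau>\<^sub>0 n\<close> only; its values elsewhere are never used.\<close>

definition beta ::
  "('a::euclidean_space \<Rightarrow> 'a) \<Rightarrow> (real \<times> 'b::euclidean_space \<Rightarrow> 'a) \<Rightarrow> (nat \<Rightarrow> real) \<Rightarrow> nat \<Rightarrow> 'a \<Rightarrow> 'a" where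
  "beta \<phi> \<tau>\<^sub>0 \<rho> n y =
     (if y \<in> RR \<phi> \<tau>\<^sub>0 \<rho> n
      then THE z. \<exists>s t x. - real n \<le> s \<and> s \<le> real n \<and> 0 < t \<and> t \<le> 2 * rr \<rho> n s \<and> norm x = 1 \<and>
             y = tau \<phi> \<tau>\<^sub>0 (s, t *\<^sub>R x) \<and> z = tau \<phi> \<tau>\<^sub>0 (s, (t / 2 + rr \<rho> n s) *\<^sub>R x)
      else y)"

definition d_n ::
  "('a::euclidean_space \<Rightarrow> 'a) \<Rightarrow> (real \<times> 'b::euclidean_space \<Rightarrow> 'a) \<Rightarrow> (nat \<Rightarrow> real) \<Rightarrow> 'a metric \<Rightarrow>
   nat \<Rightarrow> 'a \<Rightarrow> 'a \<Rightarrow> real" where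
  "d_n \<phi> \<tau>\<^sub>0 \<rho> d\<^sub>0 n x y = mdist d\<^sub>0 (beta \<phi> \<tau>\<^sub>0 \<rho> n x) (beta \<phi> \<tau>\<^sub>0 \<rho> n y)"

definition d_inf ::
  "('a::euclidean_space \<Rightarrow> 'a) \<Rightarrow> (real \<times> 'b::euclidean_space \<Rightarrow> 'a) \<Rightarrow> (nat \<Rightarrow> real) \<Rightarrow> 'a metric \<Rightarrow>
   'a \<Rightarrow> 'a \<Rightarrow> real" where
  "d_inf \<phi> \<tau>\<^sub>0 \<rho> d\<^sub>0 x y = (\<Sum>n. (1 / 2) ^ Suc n * d_n \<phi> \<tau>\<^sub>0 \<rho> d\<^sub>0 (Suc n) x y)"

text \<open>
  \<open>Z\<close> together with the embedding \<open>\<iota>\<close> is a completion of the set \<open>A\<close> in the metric \<open>\<delta>\<close>. This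
  determines \<open>Z\<close> up to a unique isometry compatible with the embeddings.
\<close>

definition completion_of :: "'a set \<Rightarrow> ('a \<Rightarrow> 'a \<Rightarrow> real) \<Rightarrow> 'z metric \<Rightarrow> ('a \<Rightarrow> 'z) \<Rightarrow> bool" where
  "completion_of A \<delta> Z \<iota> \<longleftrightarrow>
     mcomplete_of Z \<and> \<iota> ` A \<subseteq> mspace Z \<and>
     (\<forall>x\<in>A. \<forall>y\<in>A. mdist Z (\<iota> x) (\<iota> y) = \<delta> x y) \<and>
     mtopology_of Z closure_of (\<iota> ` A) = mspace Z"

section \<open>Invariant Borel probability measures\<close>

definition borel_of :: "'a topology \<Rightarrow> 'a measure" where
  "borel_of X = sigma (topspace X) {U. openin X U}"

definition invariant_probs :: "'a topology \<Rightarrow> ('a \<Rightarrow> 'a) \<Rightarrow> 'a measure set" where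
  "invariant_probs X T =
     {M. prob_space M \<and> sets M = sets (borel_of X) \<and> distr M (borel_of X) T = M}"

definition mix :: "real \<Rightarrow> 'a measure \<Rightarrow> 'a measure \<Rightarrow> 'a measure" where
  "mix t M N = measure_of (space M) (sets M)
     (\<lambda>A. ennreal t * emeasure M A + ennreal (1 - t) * emeasure N A)"

definition affine_on_measures :: "'a measure set \<Rightarrow> ('a measure \<Rightarrow> 'b measure) \<Rightarrow> bool" where
  "affine_on_measures P F \<longleftrightarrow>
     (\<forall>M\<in>P. \<forall>N\<in>P. \<forall>t\<in>{0..1}. mix t M N \<in> P \<and> F (mix t M N) = mix t (F M) (F N))"

end

theory Submission
  imports Defs
begin

text \<open>
  Only over points of \<open>L\<^sub>\<infinity>\<close> can a fibre of \<open>q\<close> have more than one point, and \<open>L\<^sub>\<infinity>\<close> is null for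
  every \<open>\<phi>\<close>-invariant probability; so \<open>q\<close> is an isomorphism of the two systems off null sets.

  Nullness: \<open>L\<^sub>\<infinity>\<close> is the disjoint union, over all integers \<open>n\<close>, of the half-open arcs
  \<open>\<tau>([n, n + 1) \<times> {0})\<close>, and \<open>\<phi>\<close> carries each arc onto the next. An invariant probability gives all
  of them the same mass, which must then be \<open>0\<close> (\<open>L_inf_null\<close>).

  Injectivity: put \<open>A = S\<^sup>d - L\<^sub>\<infinity>\<close>. The key is that the embedding \<open>\<iota>\<close> of \<open>A\<close> into \<open>Z\<close> is continuous
  for the Euclidean topology of \<open>A\<close> (\<open>continuous_iota\<close>). The distance
  \<open>d\<^sub>\<infinity>\<close> is a uniformly convergent series, so this comes down to the continuity of each \<open>\<beta>\<^sub>n\<close> off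
  \<open>L\<^sub>n\<close> (\<open>continuous_beta\<close>), and there the only delicate point is that the interior of the
  parameter region of \<open>R\<^sub>n\<close> is mapped by \<open>\<tau>\<close> onto an open subset of the sphere, which is invariance
  of domain. Once \<open>\<iota>\<close> is continuous, \<open>\<iota> \<circ> q\<close> and the identity are continuous maps on \<open>q\<^sup>-\<^sup>1(A)\<close> that
  agree on the dense subset \<open>\<iota>(A)\<close>; hence the fibre of \<open>q\<close> over \<open>x \<in> A\<close> is the single point \<open>\<iota>(x)\<close>
  (\<open>fibre_over_dense_subspace\<close>).

  Push-forward along \<open>q\<close> and push-forward along \<open>\<iota>\<close>, extended arbitrarily over \<open>L\<^sub>\<infinity>\<close>, are then mutually
  inverse on invariant probabilities (\<open>bij_betw_invariant_probs_off_null_set\<close>). Affinity holds for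
  push-forward along any measurable map.
\<close>

section \<open>Smooth maps, iterates and invariance of domain\<close>

lemma smooth_on_imp_continuous_on:
  assumes "smooth_on S f"
  shows "continuous_on S f"
  unfolding continuous_on_eq_continuous_within
proof
  fix x assume x: "x \<in> S"
  obtain U F where U: "open U" "x \<in> U" "\<And>k. Ck_on k U F" and eq: "\<And>y. y \<in> S \<inter> U \<Longrightarrow> F y = f y"
    using assms x unfolding smooth_on_def by metis
  from U(3)[of 0] have "continuous_on (S \<inter> U) F"
    using continuous_on_subset by fastforce
  then have "continuous_on (S \<inter> U) f"
    using eq continuous_on_cong by blast
  then have "continuous (at x within S \<inter> U) f"
    using x U(2) by (simp add: continuous_on_eq_continuous_within)
  then show "continuous (at x within S) f"
    using at_within_nhd[OF U(2,1), of S "S \<inter> U"] by (simp add: Int_assoc)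
qed

lemma funpow_in:
  assumes "\<And>y. y \<in> S \<Longrightarrow> f y \<in> S" "x \<in> S"
  shows "(f ^^ m) x \<in> S"
  using assms by (induction m) auto

lemma continuous_on_funpow:
  assumes "continuous_on S f" "\<And>y. y \<in> S \<Longrightarrow> f y \<in> S"
  shows "continuous_on S (f ^^ m)"
proof (induction m)
  case (Suc m)
  then show ?case
    using continuous_on_compose2[OF assms(1) Suc] funpow_in[of S f _ m] assms(2) by auto
qed (simp add: id_def)

text \<open>
  An image that is a proper subset of the sphere misses a point, and the sphere minus a point is
  homeomorphic to a Euclidean space of the right dimension, where invariance of domain applies.
\<close>

lemma sphere_invariance_of_domain:
  fixes f :: "'c::euclidean_space \<Rightarrow> 'a::euclidean_space"
  assumes dim: "DIM('c) + 1 = DIM('a)" and E: "open E" and cont: "continuous_on E f"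
    and inj: "inj_on f E" and sub: "f ` E \<subseteq> usphere"
  shows "openin (top_of_set usphere) (f ` E)"
proof (cases "f ` E = usphere")
  case True
  then show ?thesis by (metis openin_subtopology_self)
next
  case False
  then obtain p where p: "p \<in> usphere" "p \<notin> f ` E" using sub by blast
  have "int DIM('c) + 1 = int DIM('a)" using dim by linarith
  then have "(usphere - {p}) homeomorphic (UNIV :: 'c set)"
    using p(1) by (intro homeomorphic_punctured_sphere_affine) auto
  then obtain g h where gh: "homeomorphism (usphere - {p}) (UNIV :: 'c set) g h"
    by (auto simp: homeomorphic_def)
  have sub': "f ` E \<subseteq> usphere - {p}" using sub p by auto
  have cg: "continuous_on (usphere - {p}) g" and ig: "inj_on g (usphere - {p})"
    using gh by (auto simp: homeomorphism_def intro: inj_on_inverseI)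
  have "open ((g \<circ> f) ` E)"
  proof (rule invariance_of_domain[OF _ E])
    show "continuous_on E (g \<circ> f)"
      using cont continuous_on_subset[OF cg sub'] by (rule continuous_on_compose)
    show "inj_on (g \<circ> f) E"
      using inj inj_on_subset[OF ig sub'] by (rule comp_inj_on)
  qed
  then have "openin (top_of_set (usphere - {p})) ((usphere - {p}) \<inter> g -` ((g \<circ> f) ` E))"
    using cg continuous_openin_preimage_gen by blast
  moreover have "(usphere - {p}) \<inter> g -` ((g \<circ> f) ` E) = f ` E"
    using sub' ig by (auto simp: inj_on_def)
  moreover have "openin (top_of_set usphere) (usphere - {p})"
    by (simp add: openin_delete)
  ultimately show ?thesis by (metis openin_trans)
qed

section \<open>The flow box extended along the real line\<close>

locale sphere_flow_box =
  fixes \<phi> :: "'a::euclidean_space \<Rightarrow> 'a"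
    and \<epsilon> :: real
    and \<tau>\<^sub>0 :: "real \<times> 'b::euclidean_space \<Rightarrow> 'a"
  assumes diffeo: "sphere_diffeo \<phi>"
    and eps: "\<epsilon> > 0"
    and box: "flow_box \<phi> \<epsilon> \<tau>\<^sub>0"
begin

abbreviation "\<tau> \<equiv> tau \<phi> \<tau>\<^sub>0"

lemma bij: "bij_betw \<phi> usphere usphere"
  using diffeo by (simp add: sphere_diffeo_def)

lemma phi_in: "x \<in> usphere \<Longrightarrow> \<phi> x \<in> usphere"
  using bij by (auto simp: bij_betw_def)

lemma inv_phi_in: "x \<in> usphere \<Longrightarrow> inv_into usphere \<phi> x \<in> usphere"
  using bij by (metis bij_betw_def inv_into_into)

lemma continuous_phi: "continuous_on usphere \<phi>"
  and continuous_inv_phi: "continuous_on usphere (inv_into usphere \<phi>)"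
  using diffeo by (auto simp: sphere_diffeo_def intro: smooth_on_imp_continuous_on)

lemma iter_in: "x \<in> usphere \<Longrightarrow> iter \<phi> n x \<in> usphere"
  unfolding iter_def using funpow_in[of usphere] phi_in inv_phi_in by (auto simp del: mem_sphere)

lemma continuous_iter: "continuous_on usphere (iter \<phi> n)"
  unfolding iter_def
  using continuous_on_funpow[OF continuous_phi phi_in]
    continuous_on_funpow[OF continuous_inv_phi inv_phi_in] by auto

lemma iter_neg: "iter \<phi> (- int m) x = (inv_into usphere \<phi> ^^ m) x"
  by (cases m) (auto simp: iter_def nat_add_distrib)

lemma iter_Suc_left:
  assumes "x \<in> usphere"
  shows "iter \<phi> (n + 1) x = \<phi> (iter \<phi> n x)"
proof (cases "0 \<le> n")
  case True
  then have "nat (n + 1) = Suc (nat n)" by simp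
  with True show ?thesis by (simp add: iter_def)
next
  case False
  define m where "m = nat (- n - 1)"
  have m: "n = - int (Suc m)" "n + 1 = - int m"
    using False by (auto simp: m_def)
  let ?g = "inv_into usphere \<phi>"
  have "\<phi> ((?g ^^ Suc m) x) = (?g ^^ m) x"
    using funpow_in[of usphere ?g x m] inv_phi_in assms bij
    by (auto simp: bij_betw_def f_inv_into_f simp del: mem_sphere)
  then show ?thesis unfolding m(2) unfolding m(1) iter_neg by simp
qed

lemma iter_Suc_right:
  assumes "x \<in> usphere"
  shows "iter \<phi> (n + 1) x = iter \<phi> n (\<phi> x)"
proof (cases "0 \<le> n")
  case True
  then have "nat (n + 1) = Suc (nat n)" by simp
  with True show ?thesis by (simp add: iter_def funpow_swap1)
next
  case False
  define m where "m = nat (- n - 1)"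
  have m: "n = - int (Suc m)" "n + 1 = - int m"
    using False by (auto simp: m_def)
  let ?g = "inv_into usphere \<phi>"
  have "?g (\<phi> x) = x" using assms bij by (meson bij_betw_def inv_into_f_f)
  then have "(?g ^^ Suc m) (\<phi> x) = (?g ^^ m) x"
    by (simp add: funpow_Suc_right del: funpow.simps)
  then show ?thesis unfolding m(2) unfolding m(1) iter_neg by simp
qed

lemma tau0_in:
  "- \<epsilon> \<le> s \<Longrightarrow> s \<le> 1 + \<epsilon> \<Longrightarrow> x \<in> cball 0 1 \<Longrightarrow> \<tau>\<^sub>0 (s, x) \<in> usphere"
  using box unfolding flow_box_def by (auto simp: image_subset_iff)

lemma frac_dom: "- \<epsilon> \<le> frac s" "frac s \<le> 1 + \<epsilon>"
  using eps frac_lt_1[of s] frac_ge_0[of s] by linarith+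

lemma tau_in: "x \<in> cball 0 1 \<Longrightarrow> \<tau> (s, x) \<in> usphere"
  using tau0_in[OF frac_dom] iter_in by (simp add: tau_def del: mem_sphere)

lemma phi_tau:
  assumes "x \<in> cball 0 1"
  shows "\<phi> (\<tau> (s, x)) = \<tau> (s + 1, x)"
proof -
  have "frac (s + 1) = frac s" by (simp add: frac_def)
  then show ?thesis
    using iter_Suc_left[OF tau0_in[OF frac_dom assms]] by (simp add: tau_def)
qed

text \<open>
  The formula for \<open>\<tau>\<close> on \<open>[k, k + 1)\<close> stays valid a little to the left of \<open>k\<close>: this is what the
  overlap condition \<open>\<tau>\<^sub>0(s + 1, x) = \<phi>(\<tau>\<^sub>0(s, x))\<close> provides. These overlapping pieces cover the line, so
  \<open>\<tau>\<close> has no jumps at the integers.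
\<close>

lemma tau_eq_near:
  assumes s: "of_int k - min \<epsilon> 1 < s" "s < of_int k + 1" and x: "x \<in> cball 0 1"
  shows "\<tau> (s, x) = iter \<phi> k (\<tau>\<^sub>0 (s - of_int k, x))"
proof (cases "of_int k \<le> s")
  case True
  then have "\<lfloor>s\<rfloor> = k" using s by linarith
  then show ?thesis by (simp add: tau_def frac_def)
next
  case False
  then have fl: "\<lfloor>s\<rfloor> = k - 1" using s by linarith
  have "\<bar>s - of_int k\<bar> \<le> \<epsilon>" using False s by linarith
  then have "\<tau>\<^sub>0 (s - of_int k + 1, x) = \<phi> (\<tau>\<^sub>0 (s - of_int k, x))"
    using box x unfolding flow_box_def by blast
  moreover have "frac s = s - of_int k + 1" using fl by (simp add: frac_def)
  moreover have "\<tau>\<^sub>0 (s - of_int k, x) \<in> usphere"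
    using False s x by (intro tau0_in) auto
  ultimately show ?thesis
    using iter_Suc_right[of "\<tau>\<^sub>0 (s - of_int k, x)" "k - 1"] fl by (simp add: tau_def)
qed

lemma continuous_tau: "continuous_on (UNIV \<times> cball 0 1) \<tau>"
  unfolding continuous_on_eq_continuous_within
proof
  fix p :: "real \<times> 'b" assume p: "p \<in> UNIV \<times> cball 0 1"
  define k where "k = \<lfloor>fst p\<rfloor>"
  let ?I = "{of_int k - min \<epsilon> 1<..<of_int k + 1}"
  have pI: "p \<in> ?I \<times> UNIV"
    using eps unfolding k_def by (cases p) (auto, linarith+)
  have sub: "(\<lambda>p. (fst p - of_int k, snd p)) ` (?I \<times> cball 0 1)
      \<subseteq> {- \<epsilon>..1 + \<epsilon>} \<times> (cball 0 1 :: 'b set)"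
    using eps by auto
  have c0: "continuous_on ({- \<epsilon>..1 + \<epsilon>} \<times> cball 0 1) \<tau>\<^sub>0"
    using box by (simp add: flow_box_def)
  have "continuous_on (?I \<times> cball 0 1) (iter \<phi> k \<circ> (\<tau>\<^sub>0 \<circ> (\<lambda>p. (fst p - of_int k, snd p))))"
  proof (rule continuous_on_compose)
    show "continuous_on (?I \<times> cball 0 1) (\<tau>\<^sub>0 \<circ> (\<lambda>p. (fst p - of_int k, snd p)))"
      by (rule continuous_on_compose[OF _ continuous_on_subset[OF c0 sub]])
        (intro continuous_intros)
    have "\<tau>\<^sub>0 (s - of_int k, x) \<in> usphere" if "s \<in> ?I" "x \<in> cball 0 1" for s x
      using that eps by (intro tau0_in) auto
    then show "continuous_on ((\<tau>\<^sub>0 \<circ> (\<lambda>p. (fst p - of_int k, snd p))) ` (?I \<times> cball 0 1)) (iter \<phi> k)"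
      by (intro continuous_on_subset[OF continuous_iter]) (auto simp del: mem_sphere)
  qed
  then have "continuous_on (?I \<times> cball 0 1) \<tau>"
    by (rule continuous_on_eq) (auto simp: tau_eq_near[of k])
  then have "continuous (at p within ?I \<times> cball 0 1) \<tau>"
    using p pI by (auto simp: continuous_on_eq_continuous_within)
  moreover have "at p within ?I \<times> cball 0 1 = at p within UNIV \<times> cball 0 1"
    using at_within_nhd[OF pI, of "?I \<times> cball 0 1" "UNIV \<times> cball 0 1"]
    by (simp add: open_Times Times_Int_Times)
  ultimately show "continuous (at p within UNIV \<times> cball 0 1) \<tau>" by simp
qed

end

section \<open>Continuity of the radial pushes\<close>

locale sphere_blow_up = sphere_flow_box \<phi> \<epsilon> \<tau>\<^sub>0
  for \<phi> :: "'a::euclidean_space \<Rightarrow> 'a"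
    and \<epsilon> :: real
    and \<tau>\<^sub>0 :: "real \<times> 'b::euclidean_space \<Rightarrow> 'a" +
  fixes \<rho> :: "nat \<Rightarrow> real"
  assumes dim: "DIM('a) = DIM('b) + 2"
    and radii: "admissible_radii \<phi> \<tau>\<^sub>0 \<rho>"
begin

lemma radiiD:
  assumes "n \<ge> 1"
  shows "0 < \<rho> n" "2 * \<rho> n \<le> 1"
    "inj_on \<tau> ({- real n - 2..real n + 2} \<times> cball 0 (2 * \<rho> n))"
  using radii assms by (auto simp: admissible_radii_def)

text \<open>
  On \<open>[-n, n]\<close> this is the radius function \<open>r\<^sub>n\<close>, but it is continuous everywhere and negative outside
  \<open>[-n, n]\<close>. The regions below can therefore be cut out by a single inequality, which makes their
  compactness and openness immediate.
\<close>

definition rad :: "nat \<Rightarrow> real \<Rightarrow> real" where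
  "rad n s = min (\<rho> n) (real n - \<bar>s\<bar>)"

definition box_dom :: "nat \<Rightarrow> (real \<times> 'b) set" where
  "box_dom n = {p. norm (snd p) \<le> 2 * rad n (fst p)}"

definition box_int :: "nat \<Rightarrow> (real \<times> 'b) set" where
  "box_int n = {p. norm (snd p) < 2 * rad n (fst p)}"

text \<open>
  The map \<open>\<beta>\<^sub>n\<close> read in the coordinates \<open>(s, x)\<close> of \<open>\<tau>\<close>.
\<close>

definition push :: "nat \<Rightarrow> real \<times> 'b \<Rightarrow> real \<times> 'b" where
  "push n p = (fst p, (1 / 2 + rad n (fst p) / norm (snd p)) *\<^sub>R snd p)"

lemma rr_eq_rad:
  assumes "n \<ge> 1" "\<bar>s\<bar> \<le> real n"
  shows "rr \<rho> n s = rad n s"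
  using assms by (auto simp: rr_def rad_def)

lemma box_dom_abs: "p \<in> box_dom n \<Longrightarrow> \<bar>fst p\<bar> \<le> real n"
proof -
  assume "p \<in> box_dom n"
  then have "norm (snd p) \<le> 2 * rad n (fst p)" by (simp add: box_dom_def)
  then have "0 \<le> rad n (fst p)" using norm_ge_zero[of "snd p"] by linarith
  then show ?thesis by (simp add: rad_def)
qed

lemma box_dom_subset: "box_dom n \<subseteq> {- real n - 2..real n + 2} \<times> cball 0 (2 * \<rho> n)"
proof
  fix p assume p: "p \<in> box_dom n"
  with box_dom_abs[OF p] show "p \<in> {- real n - 2..real n + 2} \<times> cball 0 (2 * \<rho> n)"
    using min.cobounded1[of "\<rho> n" "real n - \<bar>fst p\<bar>"]
    by (cases p) (auto simp: box_dom_def rad_def abs_le_iff simp del: min.cobounded1)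
qed

lemma box_dom_subset_strip: "n \<ge> 1 \<Longrightarrow> box_dom n \<subseteq> UNIV \<times> cball 0 1"
  using box_dom_subset[of n] radiiD(2)[of n] by fastforce

lemma box_int_subset: "box_int n \<subseteq> box_dom n"
  by (auto simp: box_int_def box_dom_def)

lemma open_box_int: "open (box_int n)"
  unfolding box_int_def rad_def by (intro open_Collect_less continuous_intros)

lemma compact_box_dom: "compact (box_dom n)"
proof -
  have "closed (box_dom n)"
    unfolding box_dom_def rad_def by (intro closed_Collect_le continuous_intros)
  moreover have "bounded (box_dom n)"
    using box_dom_subset bounded_subset bounded_Times bounded_cball bounded_closed_interval by metis
  ultimately show ?thesis by (simp add: compact_eq_bounded_closed)
qed

lemma inj_tau_box: "n \<ge> 1 \<Longrightarrow> inj_on \<tau> (box_dom n)"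
  using radiiD(3) box_dom_subset inj_on_subset by blast

lemma continuous_tau_box: "n \<ge> 1 \<Longrightarrow> continuous_on (box_dom n) \<tau>"
  using continuous_tau box_dom_subset_strip continuous_on_subset by blast

lemma tau_box_in: "n \<ge> 1 \<Longrightarrow> p \<in> box_dom n \<Longrightarrow> \<tau> p \<in> usphere"
  using box_dom_subset_strip[of n] tau_in by (cases p) (auto simp del: mem_sphere)

lemma LL_eq:
  assumes "n \<ge> 1"
  shows "LL \<phi> \<tau>\<^sub>0 n = \<tau> ` {p \<in> box_dom n. snd p = 0}"
proof -
  have "{- real n..real n} \<times> {0} = {p \<in> box_dom n. snd p = 0}"
    using radiiD(1)[OF assms] by (auto simp: box_dom_def rad_def)
  then show ?thesis by (simp add: LL_def)
qed

lemma RR_eq: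
  assumes "n \<ge> 1"
  shows "RR \<phi> \<tau>\<^sub>0 \<rho> n = \<tau> ` {p \<in> box_dom n. snd p \<noteq> 0}"
proof -
  have "{(s, x). - real n \<le> s \<and> s \<le> real n \<and> 0 < norm x \<and> norm x \<le> 2 * rr \<rho> n s}
      = {p \<in> box_dom n. snd p \<noteq> (0::'b)}"
    (is "?L = ?R")
  proof (rule set_eqI)
    fix p :: "real \<times> 'b"
    obtain s x where p: "p = (s, x)" by (cases p)
    show "p \<in> ?L \<longleftrightarrow> p \<in> ?R"
    proof (cases "\<bar>s\<bar> \<le> real n")
      case True
      then show ?thesis using rr_eq_rad[OF assms True] by (auto simp: p box_dom_def)
    next
      case False
      then show ?thesis using box_dom_abs[of p n] by (auto simp: p)
    qed
  qed
  then show ?thesis by (simp add: RR_def)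
qed

lemma norm_push:
  assumes "p \<in> box_dom n" "snd p \<noteq> 0"
  shows "norm (snd (push n p)) = norm (snd p) / 2 + rad n (fst p)"
proof -
  have "0 \<le> rad n (fst p)" using assms(1) norm_ge_zero[of "snd p"]
    by (simp add: box_dom_def del: norm_ge_zero)
  then have "\<bar>1 / 2 + rad n (fst p) / norm (snd p)\<bar> = 1 / 2 + rad n (fst p) / norm (snd p)"
    by (intro abs_of_nonneg add_nonneg_nonneg divide_nonneg_nonneg) auto
  then show ?thesis using assms(2) by (simp add: push_def field_simps)
qed

lemma push_in:
  assumes "p \<in> box_dom n" "snd p \<noteq> 0"
  shows "push n p \<in> box_dom n"
  using norm_push[OF assms] assms(1) by (simp add: box_dom_def) (simp add: push_def)

lemma beta_tau:
  assumes n: "n \<ge> 1" and p: "p \<in> box_dom n" "snd p \<noteq> 0"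
  shows "beta \<phi> \<tau>\<^sub>0 \<rho> n (\<tau> p) = \<tau> (push n p)"
proof -
  obtain s v where sv: "p = (s, v)" by (cases p)
  have v: "v \<noteq> 0" and s: "- real n \<le> s" "s \<le> real n" and r: "rr \<rho> n s = rad n s"
    using p box_dom_abs[OF p(1)] rr_eq_rad[OF n, of s] by (auto simp: sv)
  have nv: "norm v \<le> 2 * rad n s" using p by (simp add: box_dom_def sv)
  \<comment> \<open>The formula for \<open>\<beta>\<^sub>n\<close> is in polar coordinates \<open>v = t x\<close>; this rewrites it as a multiple of \<open>v\<close>.\<close>
  have scale: "(t / 2 + rad n s) *\<^sub>R x = (1 / 2 + rad n s / norm v) *\<^sub>R v"
    if "t *\<^sub>R x = v" "norm x = 1" "t > 0" for t x
  proof -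
    have "t = norm v" using that by auto
    moreover have "x = (1 / t) *\<^sub>R v" using that by auto
    ultimately show ?thesis using v by (simp add: field_simps scaleR_add_left)
  qed
  have "(THE z. \<exists>s t x. - real n \<le> s \<and> s \<le> real n \<and> 0 < t \<and> t \<le> 2 * rr \<rho> n s \<and> norm x = 1 \<and>
      \<tau> p = \<tau> (s, t *\<^sub>R x) \<and> z = \<tau> (s, (t / 2 + rr \<rho> n s) *\<^sub>R x)) = \<tau> (push n p)"
  proof (rule the_equality)
    have "v = norm v *\<^sub>R (v /\<^sub>R norm v)" "norm (v /\<^sub>R norm v) = 1" using v by auto
    then show "\<exists>s t x. - real n \<le> s \<and> s \<le> real n \<and> 0 < t \<and> t \<le> 2 * rr \<rho> n s \<and> norm x = 1 \<and>
      \<tau> p = \<tau> (s, t *\<^sub>R x) \<and> \<tau> (push n p) = \<tau> (s, (t / 2 + rr \<rho> n s) *\<^sub>R x)"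
      using s v nv r scale[of "norm v" "v /\<^sub>R norm v"]
      by (intro exI[of _ s] exI[of _ "norm v"] exI[of _ "v /\<^sub>R norm v"]) (simp add: push_def sv)
  next
    fix z
    assume "\<exists>s t x. - real n \<le> s \<and> s \<le> real n \<and> 0 < t \<and> t \<le> 2 * rr \<rho> n s \<and> norm x = 1 \<and>
      \<tau> p = \<tau> (s, t *\<^sub>R x) \<and> z = \<tau> (s, (t / 2 + rr \<rho> n s) *\<^sub>R x)"
    then obtain s' t x where *: "- real n \<le> s'" "s' \<le> real n" "0 < t" "t \<le> 2 * rr \<rho> n s'"
      "norm x = 1" "\<tau> p = \<tau> (s', t *\<^sub>R x)" "z = \<tau> (s', (t / 2 + rr \<rho> n s') *\<^sub>R x)" by blast
    have "rr \<rho> n s' = rad n s'" using rr_eq_rad[OF n, of s'] * by auto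
    then have "(s', t *\<^sub>R x) \<in> box_dom n" using * by (simp add: box_dom_def)
    then have "p = (s', t *\<^sub>R x)" using inj_tau_box[OF n] p(1) *(6) by (auto dest: inj_onD)
    then have "s' = s" "t *\<^sub>R x = v" by (auto simp: sv)
    then show "z = \<tau> (push n p)" using *(3,5,7) scale r by (simp add: push_def sv)
  qed
  then show ?thesis using p by (simp add: beta_def RR_eq[OF n])
qed

lemma openin_tau_box_int:
  assumes "n \<ge> 1"
  shows "openin (top_of_set usphere) (\<tau> ` box_int n)"
proof (rule sphere_invariance_of_domain)
  show "DIM(real \<times> 'b) + 1 = DIM('a)" using dim by simp
  show "continuous_on (box_int n) \<tau>" "inj_on \<tau> (box_int n)"
    using continuous_tau_box[OF assms] inj_tau_box[OF assms] box_int_subset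
    by (blast intro: continuous_on_subset inj_on_subset)+
  show "\<tau> ` box_int n \<subseteq> usphere"
    using tau_box_in[OF assms] box_int_subset by blast
qed (rule open_box_int)

lemma beta_in:
  assumes "n \<ge> 1" "y \<in> usphere"
  shows "beta \<phi> \<tau>\<^sub>0 \<rho> n y \<in> usphere"
proof (cases "y \<in> RR \<phi> \<tau>\<^sub>0 \<rho> n")
  case True
  then show ?thesis
    using assms tau_box_in[OF assms(1) push_in]
    by (auto simp: RR_eq beta_tau simp del: mem_sphere split_paired_All split_paired_Ex)
qed (use assms in \<open>simp add: beta_def\<close>)

text \<open>
  The complement of \<open>L\<^sub>n\<close> is covered by two relatively closed pieces: \<open>R\<^sub>n\<close>, on which \<open>\<beta>\<^sub>n\<close> is a radial
  push in the coordinates of \<open>\<tau>\<close>, and the complement of \<open>\<tau>(box_int n)\<close>, on which \<open>\<beta>\<^sub>n\<close> is the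
  identity. The second piece is closed because \<open>\<tau>(box_int n)\<close> is open in the sphere. On the overlap
  \<open>|x| = 2 r\<^sub>n(s)\<close>, and the push is the identity as well.
\<close>

lemma continuous_beta:
  assumes n: "n \<ge> 1"
  shows "continuous_on (usphere - LL \<phi> \<tau>\<^sub>0 n) (beta \<phi> \<tau>\<^sub>0 \<rho> n)"
proof -
  define B where "B = beta \<phi> \<tau>\<^sub>0 \<rho> n"
  define R where "R = RR \<phi> \<tau>\<^sub>0 \<rho> n"
  define A where "A = usphere - LL \<phi> \<tau>\<^sub>0 n"
  define C where "C = A - \<tau> ` box_int n"
  \<comment> \<open>Injectivity of \<open>\<tau>\<close> separates \<open>R\<close> from \<open>L\<^sub>n\<close>, so \<open>R\<close> is a compact set minus \<open>L\<^sub>n\<close>.\<close>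
  have Req: "R = \<tau> ` box_dom n \<inter> A"
    using inj_tau_box[OF n] tau_box_in[OF n] unfolding R_def A_def RR_eq[OF n] LL_eq[OF n]
    by (auto dest: inj_onD simp del: mem_sphere)
  have un: "R \<union> C = A" using Req box_int_subset by (auto simp: C_def)
  obtain g where g: "homeomorphism (box_dom n) (\<tau> ` box_dom n) \<tau> g"
    using homeomorphism_compact[OF compact_box_dom continuous_tau_box[OF n] refl inj_tau_box[OF n]]
    by blast
  have gR: "g y \<in> box_dom n \<and> snd (g y) \<noteq> 0 \<and> \<tau> (g y) = y" if "y \<in> R" for y
    using that g unfolding R_def RR_eq[OF n] by (auto simp: homeomorphism_def)
  have "continuous_on R B"
  proof -
    have cg: "continuous_on R g"
      using g Req by (auto simp: homeomorphism_def intro: continuous_on_subset)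
    have "continuous_on {p \<in> box_dom n. snd p \<noteq> 0} (push n)"
      unfolding push_def rad_def by (intro continuous_intros) auto
    then have "continuous_on R (\<lambda>y. push n (g y))"
      by (rule continuous_on_compose2[OF _ cg]) (use gR in auto)
    then have "continuous_on R (\<lambda>y. \<tau> (push n (g y)))"
      by (rule continuous_on_compose2[OF continuous_tau_box[OF n]]) (use gR push_in in blast)
    then show ?thesis
      by (rule continuous_on_eq) (metis gR beta_tau[OF n] B_def)
  qed
  moreover have "closedin (top_of_set A) R"
  proof -
    have "closed (\<tau> ` box_dom n)"
      using compact_continuous_image[OF continuous_tau_box[OF n] compact_box_dom] compact_imp_closed by blast
    then show ?thesis unfolding Req by (simp add: Int_commute closedin_closed_Int)
  qed
  moreover have "closedin (top_of_set A) C"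
  proof -
    have "openin (top_of_set A) (A \<inter> \<tau> ` box_int n)"
      using openin_tau_box_int[OF n] by (auto simp: A_def openin_open)
    then have "closedin (top_of_set A) (topspace (top_of_set A) - A \<inter> \<tau> ` box_int n)"
      by (rule closedin_diff[OF closedin_topspace])
    moreover have "A - A \<inter> \<tau> ` box_int n = C" by (auto simp: C_def)
    ultimately show ?thesis by simp
  qed
  moreover have "B y = y" if "y \<in> R \<and> y \<notin> R \<or> y \<in> C \<and> y \<in> R" for y
  proof -
    have y: "y \<in> C" "y \<in> R" using that by auto
    define p where "p = g y"
    have p: "p \<in> box_dom n" "snd p \<noteq> 0" "\<tau> p = y" using gR[OF y(2)] by (auto simp: p_def)
    have "p \<notin> box_int n" using p y(1) by (auto simp: C_def)
    then have r: "norm (snd p) = 2 * rad n (fst p)" using p(1) by (auto simp: box_dom_def box_int_def)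
    moreover have "norm (snd p) > 0" using p(2) by simp
    ultimately have half: "rad n (fst p) / norm (snd p) = 1 / 2" by (simp add: field_simps)
    have "push n p = p" unfolding push_def half by simp
    then show "B y = y" using beta_tau[OF n p(1,2)] p(3) by (simp add: B_def)
  qed
  ultimately have "continuous_on (R \<union> C) (\<lambda>y. if y \<in> R then B y else y)"
    by (intro continuous_on_cases_local) (auto simp: un continuous_on_id)
  then have "continuous_on A (\<lambda>y. if y \<in> R then B y else y)" by (simp add: un)
  then have "continuous_on A B"
    by (rule continuous_on_eq) (auto simp: B_def R_def beta_def)
  then show ?thesis by (simp add: A_def B_def)
qed

end

section \<open>The completion of the complement of \<open>L\<^sub>\<infinity>\<close>\<close>

context sphere_blow_up
begin

lemma L_inf_eq_UN: "L_inf \<phi> \<tau>\<^sub>0 = (\<Union>n\<in>{1..}. LL \<phi> \<tau>\<^sub>0 n)"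
proof
  show "L_inf \<phi> \<tau>\<^sub>0 \<subseteq> (\<Union>n\<in>{1..}. LL \<phi> \<tau>\<^sub>0 n)"
  proof
    fix y assume "y \<in> L_inf \<phi> \<tau>\<^sub>0"
    then obtain s where s: "y = \<tau> (s, 0)" by (auto simp: L_inf_def)
    define n where "n = nat \<lceil>\<bar>s\<bar>\<rceil> + 1"
    have "\<bar>s\<bar> \<le> real n" unfolding n_def by linarith
    then have "y \<in> LL \<phi> \<tau>\<^sub>0 n" using s by (auto simp: LL_def abs_le_iff)
    moreover have "n \<ge> 1" by (simp add: n_def)
    ultimately show "y \<in> (\<Union>n\<in>{1..}. LL \<phi> \<tau>\<^sub>0 n)" by auto
  qed
qed (auto simp: LL_def L_inf_def)

lemma phi_L_inf_iff:
  assumes "x \<in> usphere"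
  shows "\<phi> x \<in> L_inf \<phi> \<tau>\<^sub>0 \<longleftrightarrow> x \<in> L_inf \<phi> \<tau>\<^sub>0"
proof
  assume "\<phi> x \<in> L_inf \<phi> \<tau>\<^sub>0"
  then obtain s where "\<phi> x = \<tau> (s, 0)" by (auto simp: L_inf_def)
  also have "\<dots> = \<phi> (\<tau> (s - 1, 0))" using phi_tau[of 0 "s - 1"] by simp
  finally have "x = \<tau> (s - 1, 0)"
    using assms bij tau_in[of 0 "s - 1"] by (auto simp: bij_betw_def dest: inj_onD)
  then show "x \<in> L_inf \<phi> \<tau>\<^sub>0" by (auto simp: L_inf_def)
next
  assume "x \<in> L_inf \<phi> \<tau>\<^sub>0"
  then obtain s where "x = \<tau> (s, 0)" by (auto simp: L_inf_def)
  then show "\<phi> x \<in> L_inf \<phi> \<tau>\<^sub>0" using phi_tau[of 0 s] by (auto simp: L_inf_def)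
qed

text \<open>
  Any two parameters lie in a common interval \<open>[-n, n]\<close>, where injectivity is part of the choice of
  the radii.
\<close>

lemma inj_tau_axis: "\<tau> (s, 0) = \<tau> (t, 0) \<Longrightarrow> s = t"
proof -
  assume eq: "\<tau> (s, 0) = \<tau> (t, 0)"
  define n where "n = nat \<lceil>max \<bar>s\<bar> \<bar>t\<bar>\<rceil> + 1"
  have n: "n \<ge> 1" by (simp add: n_def)
  have "\<bar>s\<bar> \<le> real n" "\<bar>t\<bar> \<le> real n" unfolding n_def by linarith+
  then have "(s, 0) \<in> {- real n - 2..real n + 2} \<times> (cball 0 (2 * \<rho> n) :: 'b set)"
    "(t, 0) \<in> {- real n - 2..real n + 2} \<times> (cball 0 (2 * \<rho> n) :: 'b set)"
    using radiiD(1)[OF n] by (auto simp: abs_le_iff)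
  then show "s = t" using radiiD(3)[OF n] eq by (auto dest: inj_onD)
qed

end

locale sphere_completion = sphere_blow_up \<phi> \<epsilon> \<tau>\<^sub>0 \<rho>
  for \<phi> :: "'a::euclidean_space \<Rightarrow> 'a"
    and \<epsilon> :: real
    and \<tau>\<^sub>0 :: "real \<times> 'b::euclidean_space \<Rightarrow> 'a"
    and \<rho> :: "nat \<Rightarrow> real" +
  fixes d\<^sub>0 :: "'a metric"
    and Z :: "'z metric"
    and \<iota> :: "'a \<Rightarrow> 'z"
  assumes d0: "mspace d\<^sub>0 = usphere" "mtopology_of d\<^sub>0 = top_of_set usphere"
    and compl: "completion_of (usphere - L_inf \<phi> \<tau>\<^sub>0) (d_inf \<phi> \<tau>\<^sub>0 \<rho> d\<^sub>0) Z \<iota>"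
begin

abbreviation "A \<equiv> usphere - L_inf \<phi> \<tau>\<^sub>0"

lemma completion_facts:
  "\<iota> ` A \<subseteq> mspace Z"
  "\<And>x y. x \<in> A \<Longrightarrow> y \<in> A \<Longrightarrow> mdist Z (\<iota> x) (\<iota> y) = d_inf \<phi> \<tau>\<^sub>0 \<rho> d\<^sub>0 x y"
  "mtopology_of Z closure_of (\<iota> ` A) = mspace Z"
  using compl by (auto simp: completion_of_def)

lemma d0_bounded:
  obtains D where "\<And>x y. x \<in> usphere \<Longrightarrow> y \<in> usphere \<Longrightarrow> mdist d\<^sub>0 x y \<le> D"
proof -
  interpret m: Metric_space usphere "mdist d\<^sub>0"
    using Metric_space_mspace_mdist[of d\<^sub>0] d0 by simp
  have "compactin (top_of_set usphere) usphere"
    by (simp add: compactin_subtopology compact_sphere)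
  then have "m.mbounded usphere"
    using m.compactin_imp_mbounded d0 by (simp add: mtopology_of_def)
  then show ?thesis using that unfolding m.mbounded_alt by blast
qed

lemma d_n_tendsto:
  assumes x: "x \<in> A"
  shows "((\<lambda>y. d_n \<phi> \<tau>\<^sub>0 \<rho> d\<^sub>0 (Suc k) x y) \<longlongrightarrow> 0) (at x within A)"
proof (rule tendstoI)
  fix e :: real assume e: "e > 0"
  interpret m: Metric_space usphere "mdist d\<^sub>0"
    using Metric_space_mspace_mdist[of d\<^sub>0] d0 by simp
  let ?b = "beta \<phi> \<tau>\<^sub>0 \<rho> (Suc k)"
  have "continuous_on A ?b"
    using continuous_beta[of "Suc k"] by (rule continuous_on_subset) (auto simp: L_inf_eq_UN)
  then have "continuous_map (top_of_set A) (top_of_set usphere) ?b"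
    using beta_in[of "Suc k"] by (auto simp: continuous_map_in_subtopology simp del: mem_sphere)
  then have "continuous_map (top_of_set A) m.mtopology ?b"
    using d0 by (simp add: mtopology_of_def)
  then obtain U where U: "openin (top_of_set A) U" "x \<in> U" "\<And>y. y \<in> U \<Longrightarrow> ?b y \<in> m.mball (?b x) e"
    using e x unfolding m.continuous_map_to_metric by (metis topspace_euclidean_subtopology)
  then obtain W where W: "open W" "U = A \<inter> W" by (auto simp: openin_open)
  then show "\<forall>\<^sub>F y in at x within A. dist (d_n \<phi> \<tau>\<^sub>0 \<rho> d\<^sub>0 (Suc k) x y) 0 < e"
    unfolding eventually_at_topological using U by (auto simp: d_n_def)
qed

text \<open>
  Each summand tends to \<open>0\<close> and the \<open>k\<close>-th one is at most \<open>2\<^sup>-\<^sup>k\<close> times the \<open>d\<^sub>0\<close>-diameter of the sphere,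
  so Tannery's theorem allows the limit to be taken under the sum.
\<close>

lemma d_inf_tendsto:
  assumes x: "x \<in> A"
  shows "((\<lambda>y. d_inf \<phi> \<tau>\<^sub>0 \<rho> d\<^sub>0 x y) \<longlongrightarrow> 0) (at x within A)"
proof (cases "at x within A = bot")
  case False
  obtain D where D: "\<And>x y. x \<in> usphere \<Longrightarrow> y \<in> usphere \<Longrightarrow> mdist d\<^sub>0 x y \<le> D"
    using d0_bounded by blast
  let ?a = "\<lambda>k y. (1 / 2) ^ Suc k * d_n \<phi> \<tau>\<^sub>0 \<rho> d\<^sub>0 (Suc k) x y"
  have "norm (?a k y) \<le> (1 / 2) ^ k * D" if "y \<in> A" for k y
  proof -
    have dn: "d_n \<phi> \<tau>\<^sub>0 \<rho> d\<^sub>0 (Suc k) x y \<le> D" "0 \<le> d_n \<phi> \<tau>\<^sub>0 \<rho> d\<^sub>0 (Suc k) x y"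
      unfolding d_n_def using that x by (auto intro!: D beta_in simp del: mem_sphere)
    then have "(1 / 2) ^ Suc k * d_n \<phi> \<tau>\<^sub>0 \<rho> d\<^sub>0 (Suc k) x y \<le> (1 / 2) ^ k * D"
      by (intro mult_mono) auto
    then show ?thesis using dn by (simp add: abs_mult)
  qed
  then have "\<forall>\<^sub>F y in at x within A. \<forall>k. norm (?a k y) \<le> (1 / 2) ^ k * D"
    unfolding eventually_at_topological by (intro exI[of _ UNIV]) auto
  then have "eventually (\<lambda>(k, y). norm (?a k y) \<le> (1 / 2) ^ k * D) (at_top \<times>\<^sub>F (at x within A))"
    unfolding eventually_prod_filter
    by (intro exI[of _ "\<lambda>_. True"] exI[of _ "\<lambda>y. \<forall>k. norm (?a k y) \<le> (1 / 2) ^ k * D"]) auto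
  moreover have "(?a k \<longlongrightarrow> 0) (at x within A)" for k
    using tendsto_mult_right_zero[OF d_n_tendsto[OF x]] by blast
  moreover have "summable (\<lambda>k. (1 / 2 :: real) ^ k * D)"
    by (intro summable_mult2 summable_geometric) auto
  ultimately have "((\<lambda>y. \<Sum>k. ?a k y) \<longlongrightarrow> (\<Sum>k. 0)) (at x within A)"
    using tannerys_theorem[of ?a "\<lambda>_. 0" "at x within A" "\<lambda>k. (1 / 2) ^ k * D"] False by blast
  then show ?thesis by (simp add: d_inf_def)
qed simp

lemma continuous_iota: "continuous_map (top_of_set A) (mtopology_of Z) \<iota>"
proof -
  interpret z: Metric_space "mspace Z" "mdist Z" by simp
  have "\<exists>U. openin (top_of_set A) U \<and> x \<in> U \<and> (\<forall>y\<in>U. \<iota> y \<in> z.mball (\<iota> x) e)"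
    if x: "x \<in> A" and e: "e > 0" for x e
  proof -
    have "\<forall>\<^sub>F y in at x within A. dist (d_inf \<phi> \<tau>\<^sub>0 \<rho> d\<^sub>0 x y) 0 < e"
      using tendstoD[OF d_inf_tendsto[OF x] e] .
    then obtain W where W: "open W" "x \<in> W"
      "\<And>y. y \<in> W \<Longrightarrow> y \<noteq> x \<Longrightarrow> y \<in> A \<Longrightarrow> dist (d_inf \<phi> \<tau>\<^sub>0 \<rho> d\<^sub>0 x y) 0 < e"
      unfolding eventually_at_topological by blast
    have "\<iota> y \<in> z.mball (\<iota> x) e" if "y \<in> A \<inter> W" for y
    proof (cases "y = x")
      case True
      moreover have "\<iota> x \<in> mspace Z" using x completion_facts(1) by blast
      ultimately show ?thesis using e by simp
    next
      case False
      then have "mdist Z (\<iota> x) (\<iota> y) < e"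
        using that x W(3)[of y] completion_facts(2)[of x y] by (auto simp del: mem_sphere)
      then show ?thesis using completion_facts(1) that x by (auto simp del: mem_sphere)
    qed
    then show ?thesis using W x by (intro exI[of _ "A \<inter> W"]) auto
  qed
  then show ?thesis
    unfolding mtopology_of_def z.continuous_map_to_metric by (auto simp del: mem_sphere)
qed

end

text \<open>
  A section \<open>j\<close> of \<open>q\<close> over \<open>A\<close> with dense image is a two-sided inverse over \<open>A\<close>: the maps \<open>j \<circ> q\<close> and
  \<open>id\<close> on \<open>q\<^sup>-\<^sup>1(A)\<close> are continuous into a Hausdorff space and agree on \<open>j(A)\<close>, which is dense in
  \<open>q\<^sup>-\<^sup>1(A)\<close>.
\<close>

lemma fibre_over_dense_subspace:
  assumes q: "continuous_map X (top_of_set S) q"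
    and j: "continuous_map (top_of_set A) X j"
    and qj: "\<And>x. x \<in> A \<Longrightarrow> q (j x) = x"
    and dense: "X closure_of (j ` A) = topspace X"
    and haus: "Hausdorff_space X"
    and z: "z \<in> topspace X" "q z \<in> A"
  shows "j (q z) = z"
proof -
  define P where "P = {z \<in> topspace X. q z \<in> A}"
  have jA: "j ` A \<subseteq> P" using j qj by (auto simp: P_def continuous_map_def)
  have "z \<in> subtopology X P closure_of (j ` A)"
    using z dense jA by (simp add: closure_of_subtopology P_def Int_absorb1)
  moreover have "continuous_map (subtopology X P) X (j \<circ> q)"
  proof (rule continuous_map_compose[OF _ j])
    have "continuous_map (subtopology X P) euclidean q"
      using q by (auto simp: continuous_map_in_subtopology intro: continuous_map_from_subtopology)
    then show "continuous_map (subtopology X P) (top_of_set A) q"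
      by (auto simp: continuous_map_in_subtopology P_def)
  qed
  moreover have "continuous_map (subtopology X P) X id"
    by (intro continuous_map_from_subtopology continuous_map_id)
  ultimately have "(j \<circ> q) z = id z"
    by (rule forall_in_closure_of_eq[OF _ haus]) (auto simp: qj)
  then show ?thesis by simp
qed

section \<open>Borel sets, mixtures and factor maps\<close>

lemma space_borel_of [simp]: "space (borel_of X) = topspace X"
  unfolding borel_of_def by (rule space_measure_of) (auto dest: openin_subset)

lemma sets_borel_of: "sets (borel_of X) = sigma_sets (topspace X) {U. openin X U}"
  unfolding borel_of_def by (rule sets_measure_of) (auto dest: openin_subset)

lemma openin_in_borel_of: "openin X U \<Longrightarrow> U \<in> sets (borel_of X)"
  by (simp add: sets_borel_of sigma_sets.Basic)

lemma closedin_in_borel_of: "closedin X C \<Longrightarrow> C \<in> sets (borel_of X)"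
  using sets.compl_sets[OF openin_in_borel_of, of X "topspace X - C"]
  by (auto simp: closedin_def double_diff)

lemma measurable_borel_ofI:
  assumes "f \<in> space M \<rightarrow> topspace Y"
    and "\<And>U. openin Y U \<Longrightarrow> f -` U \<inter> space M \<in> sets M"
  shows "f \<in> M \<rightarrow>\<^sub>M borel_of Y"
  unfolding borel_of_def using assms
  by (intro measurable_measure_of) (auto dest: openin_subset)

lemma continuous_map_measurable:
  assumes "continuous_map X Y f"
  shows "f \<in> borel_of X \<rightarrow>\<^sub>M borel_of Y"
proof (rule measurable_borel_ofI)
  fix U assume "openin Y U"
  then have "openin X {x \<in> topspace X. f x \<in> U}"
    using assms by (simp add: continuous_map_def)
  moreover have "{x \<in> topspace X. f x \<in> U} = f -` U \<inter> space (borel_of X)" by auto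
  ultimately show "f -` U \<inter> space (borel_of X) \<in> sets (borel_of X)"
    by (simp add: openin_in_borel_of)
qed (use assms in \<open>auto simp: continuous_map_def\<close>)

lemma sets_mix [simp]: "sets (mix t M N) = sets M"
  and space_mix [simp]: "space (mix t M N) = space M"
  by (simp_all add: mix_def sets.sets_measure_of_eq sets.space_measure_of_eq)

lemma emeasure_mix:
  assumes sets: "sets N = sets M" and B: "B \<in> sets M"
  shows "emeasure (mix t M N) B = ennreal t * emeasure M B + ennreal (1 - t) * emeasure N B"
  unfolding mix_def
proof (rule emeasure_measure_of_sigma)
  show "sigma_algebra (space M) (sets M)" by (rule sets.sigma_algebra_axioms)
  show "positive (sets M) (\<lambda>A. ennreal t * emeasure M A + ennreal (1 - t) * emeasure N A)"
    by (simp add: positive_def)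
  show "countably_additive (sets M) (\<lambda>A. ennreal t * emeasure M A + ennreal (1 - t) * emeasure N A)"
  proof (rule countably_additiveI)
    fix F :: "nat \<Rightarrow> 'a set"
    assume F: "range F \<subseteq> sets M" "disjoint_family F"
    have "(\<Sum>i. ennreal t * emeasure M (F i) + ennreal (1 - t) * emeasure N (F i))
        = ennreal t * (\<Sum>i. emeasure M (F i)) + ennreal (1 - t) * (\<Sum>i. emeasure N (F i))"
      by (simp add: suminf_add[symmetric] ennreal_suminf_cmult)
    also have "\<dots> = ennreal t * emeasure M (\<Union>i. F i) + ennreal (1 - t) * emeasure N (\<Union>i. F i)"
      using F sets by (simp add: suminf_emeasure)
    finally show "(\<Sum>i. ennreal t * emeasure M (F i) + ennreal (1 - t) * emeasure N (F i))
        = ennreal t * emeasure M (\<Union>i. F i) + ennreal (1 - t) * emeasure N (\<Union>i. F i)" .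
  qed
qed (rule B)

lemma prob_space_mix:
  assumes "prob_space M" "prob_space N" "sets N = sets M" "t \<in> {0..1}"
  shows "prob_space (mix t M N)"
proof
  have "space N = space M" using assms(3) by (rule sets_eq_imp_space_eq)
  then have "emeasure M (space M) = 1" "emeasure N (space M) = 1"
    using assms(1,2) prob_space.emeasure_space_1 by fastforce+
  then show "emeasure (mix t M N) (space (mix t M N)) = 1"
    using assms(3,4) by (simp add: emeasure_mix flip: ennreal_plus)
qed

lemma distr_mix:
  assumes sets: "sets N = sets M" and f: "f \<in> M \<rightarrow>\<^sub>M K"
  shows "distr (mix t M N) K f = mix t (distr M K f) (distr N K f)"
proof (rule measure_eqI)
  fix B assume "B \<in> sets (distr (mix t M N) K f)"
  then have B: "B \<in> sets K" by simp
  have f': "f \<in> N \<rightarrow>\<^sub>M K" "f \<in> mix t M N \<rightarrow>\<^sub>M K"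
    using f sets by (simp_all cong: measurable_cong_sets)
  have "f -` B \<inter> space M \<in> sets M" using f B by (rule measurable_sets)
  then show "emeasure (distr (mix t M N) K f) B = emeasure (mix t (distr M K f) (distr N K f)) B"
    using B f f' sets sets_eq_imp_space_eq[OF sets] by (simp add: emeasure_distr emeasure_mix)
qed simp

lemma invariant_probs_factor:
  assumes T: "T \<in> borel_of X \<rightarrow>\<^sub>M borel_of X" and f: "f \<in> borel_of Y \<rightarrow>\<^sub>M borel_of Y"
    and q: "q \<in> borel_of X \<rightarrow>\<^sub>M borel_of Y"
    and qT: "\<And>z. z \<in> topspace X \<Longrightarrow> q (T z) = f (q z)"
    and M: "M \<in> invariant_probs X T"
  shows "distr M (borel_of Y) q \<in> invariant_probs Y f"
proof -
  have sM: "sets M = sets (borel_of X)" and pM: "prob_space M"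
    and inv: "distr M (borel_of X) T = M"
    using M by (auto simp: invariant_probs_def)
  note [measurable_cong] = sM
  note [measurable] = T f q
  have sp: "space M = topspace X" using sets_eq_imp_space_eq[OF sM] by simp
  have "distr (distr M (borel_of Y) q) (borel_of Y) f = distr M (borel_of Y) (f \<circ> q)"
    by (rule distr_distr) measurable
  also have "\<dots> = distr M (borel_of Y) (q \<circ> T)"
    by (rule distr_cong) (auto simp: sp qT)
  also have "\<dots> = distr (distr M (borel_of X) T) (borel_of Y) q"
    by (rule distr_distr[symmetric]) measurable
  also have "\<dots> = distr M (borel_of Y) q" by (simp add: inv)
  finally show ?thesis
    using prob_space.prob_space_distr[OF pM, of q "borel_of Y"]
    by (simp add: invariant_probs_def)
qed

lemma affine_on_invariant_probs:
  assumes T: "T \<in> borel_of X \<rightarrow>\<^sub>M borel_of X" and q: "q \<in> borel_of X \<rightarrow>\<^sub>M K"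
  shows "affine_on_measures (invariant_probs X T) (\<lambda>M. distr M K q)"
  unfolding affine_on_measures_def
proof (intro ballI conjI)
  fix M N t
  assume *: "M \<in> invariant_probs X T" "N \<in> invariant_probs X T" "t \<in> {0..1::real}"
  have s: "sets M = sets (borel_of X)" "sets N = sets M"
    using * by (auto simp: invariant_probs_def)
  have m: "T \<in> M \<rightarrow>\<^sub>M borel_of X" "q \<in> M \<rightarrow>\<^sub>M K"
    using T q s by (simp_all cong: measurable_cong_sets)
  show "distr (mix t M N) K q = mix t (distr M K q) (distr N K q)"
    by (rule distr_mix[OF s(2) m(2)])
  show "mix t M N \<in> invariant_probs X T"
    using * s distr_mix[OF s(2) m(1), of t] prob_space_mix[of M N t]
    by (simp add: invariant_probs_def)
qed

text \<open>
  If \<open>N\<close> is null for all invariant measures downstairs, then \<open>q\<^sup>-\<^sup>1(N)\<close> is null for all invariant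
  measures upstairs, since these push forward to invariant ones. Up to these null sets \<open>q\<close> and \<open>j\<close>
  are mutually inverse conjugacies, and push-forward only sees maps up to null sets.
\<close>

lemma bij_betw_invariant_probs_off_null_set:
  assumes T: "T \<in> borel_of X \<rightarrow>\<^sub>M borel_of X" and f: "f \<in> borel_of Y \<rightarrow>\<^sub>M borel_of Y"
    and q: "q \<in> borel_of X \<rightarrow>\<^sub>M borel_of Y" and j: "j \<in> borel_of Y \<rightarrow>\<^sub>M borel_of X"
    and qT: "\<And>z. z \<in> topspace X \<Longrightarrow> q (T z) = f (q z)"
    and null: "\<And>M. M \<in> invariant_probs Y f \<Longrightarrow> N \<in> null_sets M"
    and jq: "\<And>z. z \<in> topspace X \<Longrightarrow> q z \<notin> N \<Longrightarrow> j (q z) = z"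
    and qj: "\<And>y. y \<in> topspace Y - N \<Longrightarrow> q (j y) = y"
    and Tj: "\<And>y. y \<in> topspace Y - N \<Longrightarrow> T (j y) = j (f y)"
  shows "bij_betw (\<lambda>M. distr M (borel_of Y) q) (invariant_probs X T) (invariant_probs Y f)"
proof (rule bij_betw_byWitness[where f' = "\<lambda>M. distr M (borel_of X) j"])
  note [measurable] = T f q j
  show push: "(\<lambda>M. distr M (borel_of Y) q) ` invariant_probs X T \<subseteq> invariant_probs Y f"
    using invariant_probs_factor[OF T f q qT] by blast
  have AE_N: "AE y in M. y \<in> topspace Y - N"
    if M: "M \<in> invariant_probs Y f" for M
  proof -
    have "space M = topspace Y"
      using M sets_eq_imp_space_eq[of M "borel_of Y"] by (simp add: invariant_probs_def)
    moreover have "AE y in M. y \<notin> N" using null[OF M] by (rule AE_not_in)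
    ultimately show ?thesis using AE_space[of M] by (auto elim: eventually_elim2)
  qed
  show "\<forall>M\<in>invariant_probs X T. distr (distr M (borel_of Y) q) (borel_of X) j = M"
  proof
    fix M assume M: "M \<in> invariant_probs X T"
    have sM: "sets M = sets (borel_of X)" using M by (simp add: invariant_probs_def)
    note [measurable_cong] = sM
    have sp: "space M = topspace X" using sets_eq_imp_space_eq[OF sM] by simp
    have "AE y in distr M (borel_of Y) q. y \<in> topspace Y - N" using push M AE_N by blast
    then have "AE z in M. q z \<in> topspace Y - N" by (rule AE_distrD[rotated]) measurable
    then have "AE z in M. (j \<circ> q) z = z" using AE_space[of M]
      by eventually_elim (simp add: sp jq)
    then have "distr M (borel_of X) (j \<circ> q) = distr M M (\<lambda>z. z)"
      using sM by (intro distr_cong_AE) measurable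
    then show "distr (distr M (borel_of Y) q) (borel_of X) j = M" by (simp add: distr_distr)
  qed
  show "\<forall>M\<in>invariant_probs Y f. distr (distr M (borel_of X) j) (borel_of Y) q = M"
  proof
    fix M assume M: "M \<in> invariant_probs Y f"
    have sM: "sets M = sets (borel_of Y)" using M by (simp add: invariant_probs_def)
    note [measurable_cong] = sM
    have "AE y in M. (q \<circ> j) y = y" using AE_N[OF M] by eventually_elim (simp add: qj)
    then have "distr M (borel_of Y) (q \<circ> j) = distr M M (\<lambda>y. y)"
      using sM by (intro distr_cong_AE) measurable
    then show "distr (distr M (borel_of X) j) (borel_of Y) q = M" by (simp add: distr_distr)
  qed
  show "(\<lambda>M. distr M (borel_of X) j) ` invariant_probs Y f \<subseteq> invariant_probs X T"
  proof (rule image_subsetI)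
    fix M assume M: "M \<in> invariant_probs Y f"
    have sM: "sets M = sets (borel_of Y)" and pM: "prob_space M"
      and inv: "distr M (borel_of Y) f = M"
      using M by (auto simp: invariant_probs_def)
    note [measurable_cong] = sM
    have "distr (distr M (borel_of X) j) (borel_of X) T = distr M (borel_of X) (T \<circ> j)"
      by (rule distr_distr) measurable
    also have "\<dots> = distr M (borel_of X) (j \<circ> f)"
    proof (rule distr_cong_AE)
      show "AE y in M. (T \<circ> j) y = (j \<circ> f) y"
        using AE_N[OF M] by eventually_elim (simp add: Tj)
      show "T \<circ> j \<in> M \<rightarrow>\<^sub>M borel_of X" "j \<circ> f \<in> M \<rightarrow>\<^sub>M borel_of X"
        by measurable
    qed simp_all
    also have "\<dots> = distr (distr M (borel_of Y) f) (borel_of X) j"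
      by (rule distr_distr[symmetric]) measurable
    also have "\<dots> = distr M (borel_of X) j" by (simp add: inv)
    finally show "distr M (borel_of X) j \<in> invariant_probs X T"
      using prob_space.prob_space_distr[OF pM, of j "borel_of X"]
      by (simp add: invariant_probs_def)
  qed
qed

section \<open>Nullity of \<open>L\<^sub>\<infinity>\<close>\<close>

context sphere_blow_up
begin

definition unit_arc :: "int \<Rightarrow> 'a set" where
  "unit_arc n = \<tau> ` ({of_int n..<of_int n + 1} \<times> {0})"

lemma L_inf_eq_arcs: "L_inf \<phi> \<tau>\<^sub>0 = (\<Union>n. unit_arc n)"
proof
  show "L_inf \<phi> \<tau>\<^sub>0 \<subseteq> (\<Union>n. unit_arc n)"
  proof
    fix y assume "y \<in> L_inf \<phi> \<tau>\<^sub>0"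
    then obtain s where "y = \<tau> (s, 0)" by (auto simp: L_inf_def)
    then have "y \<in> unit_arc \<lfloor>s\<rfloor>" by (auto simp: unit_arc_def)
    then show "y \<in> (\<Union>n. unit_arc n)" by blast
  qed
qed (auto simp: unit_arc_def L_inf_def)

lemma disjoint_arcs: "m \<noteq> n \<Longrightarrow> unit_arc m \<inter> unit_arc n = {}"
proof (rule ccontr)
  assume "m \<noteq> n" "unit_arc m \<inter> unit_arc n \<noteq> {}"
  then obtain s t where "\<tau> (s, 0) = \<tau> (t, 0)" "s \<in> {of_int m..<of_int m + 1}"
    "t \<in> {of_int n..<of_int n + 1}" unfolding unit_arc_def by blast
  then have "\<lfloor>s\<rfloor> = m" "\<lfloor>s\<rfloor> = n" using inj_tau_axis[of s t] by (auto simp: floor_unique)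
  with \<open>m \<noteq> n\<close> show False by simp
qed

lemma arc_subset: "unit_arc n \<subseteq> usphere"
  using tau_in[of 0] by (auto simp: unit_arc_def)

text \<open>
  A half-open arc is the union of countably many compact ones.
\<close>

lemma arc_in_borel: "unit_arc n \<in> sets (borel_of (top_of_set usphere))"
proof -
  let ?K = "\<lambda>k. {of_int n..of_int n + 1 - 1 / real (Suc k)} \<times> {0 :: 'b}"
  have "\<exists>k. s \<le> of_int n + 1 - 1 / real (Suc k)" if s: "s < of_int n + 1" for s :: real
  proof -
    obtain k where "1 / real (Suc k) < of_int n + 1 - s"
      using s nat_approx_posE[of "of_int n + 1 - s"] by auto
    then show ?thesis by (intro exI[of _ k]) linarith
  qed
  moreover have "s < of_int n + 1" if "s \<le> of_int n + 1 - 1 / real (Suc k)" for s k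
  proof -
    have "1 / real (Suc k) > 0" by simp
    with that show ?thesis by linarith
  qed
  ultimately have "{of_int n..<of_int n + 1} \<times> {0} = (\<Union>k. ?K k)" by fastforce
  then have "unit_arc n = (\<Union>k. \<tau> ` ?K k)" by (simp only: unit_arc_def image_UN)
  moreover have "\<tau> ` ?K k \<in> sets (borel_of (top_of_set usphere))" for k
  proof (rule closedin_in_borel_of)
    have "continuous_on (?K k) \<tau>"
      using continuous_tau by (rule continuous_on_subset) auto
    then have "compact (\<tau> ` ?K k)"
      by (rule compact_continuous_image) (intro compact_Times compact_Icc compact_sing)
    moreover have "\<tau> ` ?K k \<subseteq> usphere" using tau_in[of 0] by auto
    ultimately show "closedin (top_of_set usphere) (\<tau> ` ?K k)"
      by (simp add: closed_subset compact_imp_closed)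
  qed
  ultimately show ?thesis by auto
qed

lemma vimage_phi_arc: "\<phi> -` unit_arc (n + 1) \<inter> usphere = unit_arc n"
proof (intro equalityI subsetI)
  fix x assume "x \<in> \<phi> -` unit_arc (n + 1) \<inter> usphere"
  then obtain s where x: "x \<in> usphere" and s: "\<phi> x = \<tau> (s, 0)"
    and sn: "of_int n + 1 \<le> s" "s < of_int n + 1 + 1" by (auto simp: unit_arc_def)
  have "\<phi> x = \<phi> (\<tau> (s - 1, 0))" using phi_tau[of 0 "s - 1"] s by simp
  then have "x = \<tau> (s - 1, 0)"
    using x bij tau_in[of 0 "s - 1"] by (auto simp: bij_betw_def dest: inj_onD)
  then show "x \<in> unit_arc n" using sn by (auto simp: unit_arc_def)
next
  fix x assume x: "x \<in> unit_arc n"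
  then obtain s where "x = \<tau> (s, 0)" "of_int n \<le> s" "s < of_int n + 1" by (auto simp: unit_arc_def)
  then have "\<phi> x \<in> unit_arc (n + 1)" using phi_tau[of 0 s] by (auto simp: unit_arc_def)
  then show "x \<in> \<phi> -` unit_arc (n + 1) \<inter> usphere" using x arc_subset by blast
qed

text \<open>
  By invariance all unit arcs have the same mass. Infinitely many disjoint sets of equal mass fit into
  a probability space only if that mass is \<open>0\<close>.
\<close>

lemma L_inf_null:
  assumes M: "M \<in> invariant_probs (top_of_set usphere) \<phi>"
  shows "L_inf \<phi> \<tau>\<^sub>0 \<in> null_sets M"
proof -
  have sM: "sets M = sets (borel_of (top_of_set usphere))"
    and inv: "distr M (borel_of (top_of_set usphere)) \<phi> = M"
    using M by (auto simp: invariant_probs_def)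
  have sp: "space M = usphere" using sets_eq_imp_space_eq[OF sM] by simp
  interpret prob_space M using M by (simp add: invariant_probs_def)
  have arc_sets: "unit_arc n \<in> sets M" for n using arc_in_borel sM by simp
  have "continuous_map (top_of_set usphere) (top_of_set usphere) \<phi>"
    using continuous_phi phi_in by (auto simp: continuous_map_in_subtopology simp del: mem_sphere)
  then have phi_meas: "\<phi> \<in> M \<rightarrow>\<^sub>M borel_of (top_of_set usphere)"
    using measurable_cong_sets[OF sM refl] by (blast dest: continuous_map_measurable)
  have step: "measure M (unit_arc (n + 1)) = measure M (unit_arc n)" for n
    using measure_distr[OF phi_meas arc_in_borel, of "n + 1"] by (simp add: inv sp vimage_phi_arc)
  have const: "measure M (unit_arc n) = measure M (unit_arc 0)" for n
  proof (induction n rule: int_induct[of _ 0])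
    case (step2 i) then show ?case using step[of "i - 1"] by simp
  qed (simp_all add: step)
  have "disjoint_family (\<lambda>k::nat. unit_arc (int k))"
    using disjoint_arcs by (auto simp: disjoint_family_on_def)
  then have "(\<lambda>k::nat. measure M (unit_arc (int k))) sums measure M (\<Union>k. unit_arc (int k))"
    using arc_sets by (intro finite_measure_UNION) auto
  then have "summable (\<lambda>k::nat. measure M (unit_arc 0))"
    unfolding const[of "int _"] by (rule sums_summable)
  then have "measure M (unit_arc n) = 0" for n
    using const by (simp add: summable_const_iff)
  then have "unit_arc n \<in> null_sets M" for n
    using arc_sets by (simp add: null_sets_def emeasure_eq_measure)
  then show ?thesis unfolding L_inf_eq_arcs by (intro null_sets_UN)
qed

end

section \<open>Invariant measures of the blow-up and of the sphere\<close>

theorem theorem1p18: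
  fixes d :: nat
    and \<phi> :: "'a::euclidean_space \<Rightarrow> 'a"
    and \<epsilon> :: real
    and \<tau>\<^sub>0 :: "real \<times> 'b::euclidean_space \<Rightarrow> 'a"
    and \<rho> :: "nat \<Rightarrow> real"
    and d\<^sub>0 :: "'a metric"
    and Z :: "'z metric"
    and \<iota> :: "'a \<Rightarrow> 'z"
    and \<zeta> :: "'z \<Rightarrow> 'z"
    and q :: "'z \<Rightarrow> 'a"
  assumes "odd d" and "d > 1"
    and "DIM('a) = d + 1" and "DIM('b) = d - 1"
    and "sphere_diffeo \<phi>" and "minimal_on_sphere \<phi>"
    and "\<epsilon> > 0" and "flow_box \<phi> \<epsilon> \<tau>\<^sub>0"
    and "admissible_radii \<phi> \<tau>\<^sub>0 \<rho>"
    and "mspace d\<^sub>0 = usphere" and "mtopology_of d\<^sub>0 = top_of_set usphere"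
    and "completion_of (usphere - L_inf \<phi> \<tau>\<^sub>0) (d_inf \<phi> \<tau>\<^sub>0 \<rho> d\<^sub>0) Z \<iota>"
    and "homeomorphic_map (mtopology_of Z) (mtopology_of Z) \<zeta>"
    and "\<forall>x \<in> usphere - L_inf \<phi> \<tau>\<^sub>0. \<zeta> (\<iota> x) = \<iota> (\<phi> x)"
    and "continuous_map (mtopology_of Z) (top_of_set usphere) q"
    and "\<forall>x \<in> usphere - L_inf \<phi> \<tau>\<^sub>0. q (\<iota> x) = x"
  shows "bij_betw (\<lambda>M. distr M (borel_of (top_of_set usphere)) q)
           (invariant_probs (mtopology_of Z) \<zeta>)
           (invariant_probs (top_of_set usphere) \<phi>) \<and>
         affine_on_measures (invariant_probs (mtopology_of Z) \<zeta>)
           (\<lambda>M. distr M (borel_of (top_of_set usphere)) q)"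
proof -
  interpret sphere_completion \<phi> \<epsilon> \<tau>\<^sub>0 \<rho> d\<^sub>0 Z \<iota>
    using assms by unfold_locales auto
  let ?X = "mtopology_of Z" and ?Y = "top_of_set usphere :: 'a topology"
  let ?A = "usphere - L_inf \<phi> \<tau>\<^sub>0"
  note q = assms(15)
  have \<zeta>: "continuous_map ?X ?X \<zeta>"
    using assms(13) by (rule homeomorphic_imp_continuous_map)
  have \<zeta>\<iota>: "\<zeta> (\<iota> x) = \<iota> (\<phi> x)" and q\<iota>: "q (\<iota> x) = x" if "x \<in> ?A" for x
    using assms(14,16) that by blast+
  have \<phi>A: "\<phi> x \<in> ?A" if "x \<in> ?A" for x
    using that phi_L_inf_iff phi_in by (metis DiffD1 DiffD2 DiffI)
  have \<phi>: "continuous_map ?Y ?Y \<phi>"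
    using continuous_phi phi_in by (auto simp: continuous_map_in_subtopology simp del: mem_sphere)
  have haus: "Hausdorff_space ?X"
    using Metric_space.Hausdorff_space_mtopology[OF Metric_space_mspace_mdist]
    by (simp add: mtopology_of_def)
  \<comment> \<open>The conjugacy relation holds on \<open>\<iota>(A)\<close> and extends to \<open>Z\<close> by density.\<close>
  have q\<zeta>: "q (\<zeta> z) = \<phi> (q z)" if "z \<in> topspace ?X" for z
  proof -
    have "(q \<circ> \<zeta>) z = (\<phi> \<circ> q) z"
    proof (rule forall_in_closure_of_eq[where f = "q \<circ> \<zeta>" and g = "\<phi> \<circ> q" and x = z])
      show "z \<in> ?X closure_of (\<iota> ` ?A)" using that completion_facts(3) by simp
      show "Hausdorff_space ?Y" by (simp add: Hausdorff_space_subtopology)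
      show "continuous_map ?X ?Y (q \<circ> \<zeta>)" using \<zeta> q by (rule continuous_map_compose)
      show "continuous_map ?X ?Y (\<phi> \<circ> q)" using q \<phi> by (rule continuous_map_compose)
      show "(q \<circ> \<zeta>) x = (\<phi> \<circ> q) x" if "x \<in> \<iota> ` ?A" for x
        using that \<phi>A \<zeta>\<iota> q\<iota> by auto
    qed
    then show ?thesis by simp
  qed
  have meas: "\<zeta> \<in> borel_of ?X \<rightarrow>\<^sub>M borel_of ?X" "\<phi> \<in> borel_of ?Y \<rightarrow>\<^sub>M borel_of ?Y"
    "q \<in> borel_of ?X \<rightarrow>\<^sub>M borel_of ?Y"
    using \<zeta> \<phi> q by (simp_all add: continuous_map_measurable)
  have "bij_betw (\<lambda>M. distr M (borel_of ?Y) q) (invariant_probs ?X \<zeta>) (invariant_probs ?Y \<phi>)"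
  \<comment> \<open>An inverse map needs a point of \<open>Z\<close> as value on \<open>L\<^sub>\<infinity>\<close>. If \<open>A\<close> is empty there is none, but then
      neither system carries an invariant probability: \<open>Z\<close> is empty, and \<open>L\<^sub>\<infinity>\<close> is the whole sphere.\<close>
  proof (cases "?A = {}")
    case True
    have "topspace ?X = {}" using completion_facts(3) True by simp
    then have "invariant_probs ?X \<zeta> = {}"
      by (auto simp: invariant_probs_def dest!: sets_eq_imp_space_eq prob_space.not_empty)
    moreover have "invariant_probs ?Y \<phi> = {}"
    proof (rule ccontr)
      assume "invariant_probs ?Y \<phi> \<noteq> {}"
      then obtain M where M: "M \<in> invariant_probs ?Y \<phi>" by blast
      then interpret prob_space M by (simp add: invariant_probs_def)
      have "space M = usphere"
        using M sets_eq_imp_space_eq[of M "borel_of ?Y"] by (simp add: invariant_probs_def)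
      also have "\<dots> \<subseteq> L_inf \<phi> \<tau>\<^sub>0" using True by blast
      finally have "space M \<in> null_sets M" using null_sets_subset[OF L_inf_null[OF M]] by blast
      then show False using emeasure_space_1 by (auto simp: null_sets_def)
    qed
    ultimately show ?thesis by (simp add: bij_betw_def)
  next
    case False
    then obtain a where a: "a \<in> ?A" by blast
    define j where "j y = \<iota> (if y \<in> ?A then y else a)" for y
    have j_in: "j y \<in> topspace ?X" for y
      using completion_facts(1) a by (auto simp: j_def)
    have L_borel: "L_inf \<phi> \<tau>\<^sub>0 \<in> sets (borel_of ?Y)"
      unfolding L_inf_eq_arcs using arc_in_borel by blast
    have A_borel: "?A \<in> sets (borel_of ?Y)"
      using sets.compl_sets[OF L_borel] by simp
    have "j \<in> borel_of ?Y \<rightarrow>\<^sub>M borel_of ?X"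
    proof (rule measurable_borel_ofI)
      fix U assume U: "openin ?X U"
      have "openin (top_of_set ?A) {x \<in> ?A. \<iota> x \<in> U}"
        using continuous_iota U by (simp add: continuous_map_def)
      then obtain W where W: "open W" "{x \<in> ?A. \<iota> x \<in> U} = ?A \<inter> W"
        by (auto simp: openin_open)
      have "?A \<inter> (usphere \<inter> W) \<in> sets (borel_of ?Y)"
        using A_borel openin_in_borel_of[of ?Y "usphere \<inter> W"] W(1) by (auto simp: openin_open_Int)
      moreover have "?A \<inter> (usphere \<inter> W) = {x \<in> ?A. \<iota> x \<in> U}" using W(2) by blast
      ultimately have 1: "{x \<in> ?A. \<iota> x \<in> U} \<in> sets (borel_of ?Y)" by metis
      have 2: "(if \<iota> a \<in> U then L_inf \<phi> \<tau>\<^sub>0 else {}) \<in> sets (borel_of ?Y)" using L_borel by simp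
      have "L_inf \<phi> \<tau>\<^sub>0 \<subseteq> usphere" using sets.sets_into_space[OF L_borel] by simp
      then have "j -` U \<inter> space (borel_of ?Y)
          = {x \<in> ?A. \<iota> x \<in> U} \<union> (if \<iota> a \<in> U then L_inf \<phi> \<tau>\<^sub>0 else {})"
        by (auto simp: j_def split: if_splits)
      then show "j -` U \<inter> space (borel_of ?Y) \<in> sets (borel_of ?Y)" using 1 2 by (simp only: sets.Un)
    qed (use j_in in auto)
    then show ?thesis
    proof (rule bij_betw_invariant_probs_off_null_set[where N = "L_inf \<phi> \<tau>\<^sub>0", OF meas])
      show "j (q z) = z" if "z \<in> topspace ?X" "q z \<notin> L_inf \<phi> \<tau>\<^sub>0" for z
      proof -
        have "q z \<in> ?A" using that continuous_map_image_subset_topspace[OF q] by auto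
        then show ?thesis
          using fibre_over_dense_subspace[OF q continuous_iota q\<iota> _ haus that(1)] completion_facts(3)
          by (simp add: j_def)
      qed
      show "q (j y) = y" "\<zeta> (j y) = j (\<phi> y)" if "y \<in> topspace ?Y - L_inf \<phi> \<tau>\<^sub>0" for y
        using that \<phi>A[of y] \<zeta>\<iota>[of y] q\<iota>[of y] by (auto simp: j_def)
    qed (simp_all add: q\<zeta> L_inf_null)
  qed
  moreover have "affine_on_measures (invariant_probs ?X \<zeta>) (\<lambda>M. distr M (borel_of ?Y) q)"
    using meas(1,3) by (rule affine_on_invariant_probs)
  ultimately show ?thesis by blast
qed

end
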